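(* Let $X=L^2[0,1]$, let $V:X\to X$ be the Volterra integration operator $(Vx)(t)=\int_0^tx$, and let $V_\circ:L^2[0,1]\to L^2[0,1]$ be given by $V_\circ=\frac{V-V^*}{2}$. Define $T_2:\operatorname{dom}T_2\to L^2[0,1]$ by $T_2=V_\circ^{-1}$. Then: (i) $T_2x=x'$ for all $x\in\operatorname{dom}T_2$, where $$\operatorname{dom}T_2=\{x\in L^2[0,1]: x\text{ is absolutely continuous on }[0,1],\ x'\in L^2[0,1],\ x(0)=-x(1)\}.$$ (ii) $T_2^*=-T_2$, and both $T_2$ and $-T_2$ are maximal monotone and skew.
   Context: $L^2[0,1]$ is the real Hilbert space of (classes of) square-integrable real functions on $[0,1]$ with inner product $\langle x,y\rangle=\int_0^1xy$. An element is called absolutely continuous if it has an absolutely continuous representative on $[0,1]$; point values $x(0),x(1)$ refer to that representative, and $x'$ is its (a.e.) derivative. The adjoint of $V$ is $(V^*x)(t)=\int_t^1x$. For a set-valued operator $A:X\rightrightarrows X$, $\operatorname{gra}A=\{(x,x^* )\in X\times X\mid x^*\in Ax\}$, $\operatorname{dom}A=\{x\mid Ax\ne\varnothing\}$, and $A^{-1}$ is the operator with graph $\{(x^*,x)\mid(x,x^* )\in\operatorname{gra}A\}$. At most single-valued linear relations (operators whose graph is a linear subspace) are identified with linear operators on their domains. $A$ is monotone if $\langle x-y,x^*-y^*\rangle\ge0$ for all $(x,x^* ),(y,y^* )\in\operatorname{gra}A$, and maximal monotone if monotone with no proper monotone enlargement (in the sense of graph inclusion). For a linear relation $A$, the adjoint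 $A^*$ is defined by $\operatorname{gra}A^*=\{(x,x^* )\mid(x^*,-x)\in(\operatorname{gra}A)^\perp\}$, and $A$ is skew if $\langle x,x^*\rangle=0$ for all $(x,x^* )\in\operatorname{gra}A$. *)

theory Defs
  imports "HOL-Analysis.Analysis"
begin

section \<open>Set-valued operators on a real inner product space\<close>

definition gra :: "('a \<Rightarrow> 'a set) \<Rightarrow> ('a \<times> 'a) set" where
  "gra A = {(x, u). u \<in> A x}"

definition op_dom :: "('a \<Rightarrow> 'a set) \<Rightarrow> 'a set" where
  "op_dom A = {x. A x \<noteq> {}}"

definition op_inverse :: "('a \<Rightarrow> 'a set) \<Rightarrow> 'a \<Rightarrow> 'a set" where
  "op_inverse A = (\<lambda>u. {x. (x, u) \<in> gra A})"

definition op_uminus :: "('a::real_vector \<Rightarrow> 'a set) \<Rightarrow> 'a \<Rightarrow> 'a set" where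
  "op_uminus A = (\<lambda>x. uminus ` A x)"

definition op_of_fun :: "('a \<Rightarrow> 'a) \<Rightarrow> 'a \<Rightarrow> 'a set" where
  "op_of_fun f = (\<lambda>x. {f x})"

definition linear_relation :: "('a::real_vector \<Rightarrow> 'a set) \<Rightarrow> bool" where
  "linear_relation A \<longleftrightarrow> subspace (gra A)"

definition op_adjoint :: "('a::real_inner \<Rightarrow> 'a set) \<Rightarrow> 'a \<Rightarrow> 'a set" where
  "op_adjoint A = (\<lambda>x. {u. (u, - x) \<in> orthogonal_comp (gra A)})"

text \<open>Skewness is a notion for linear relations only, hence the first conjunct.\<close>

definition skew_op :: "('a::real_inner \<Rightarrow> 'a set) \<Rightarrow> bool" where
  "skew_op A \<longleftrightarrow> linear_relation A \<and> (\<forall>(x, u) \<in> gra A. inner x u = 0)"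

definition monotone_op :: "('a::real_inner \<Rightarrow> 'a set) \<Rightarrow> bool" where
  "monotone_op A \<longleftrightarrow>
     (\<forall>(x, u) \<in> gra A. \<forall>(y, v) \<in> gra A. inner (x - y) (u - v) \<ge> 0)"

definition maximal_monotone_op :: "('a::real_inner \<Rightarrow> 'a set) \<Rightarrow> bool" where
  "maximal_monotone_op A \<longleftrightarrow>
     monotone_op A \<and> \<not> (\<exists>B. monotone_op B \<and> gra A \<subset> gra B)"


section \<open>The real inner product space of classes of square-integrable functions on the unit interval\<close>

abbreviation unit_leb :: "real measure" where
  "unit_leb \<equiv> lebesgue_on {0..1}"

definition sq_integrable :: "(real \<Rightarrow> real) \<Rightarrow> bool" where
  "sq_integrable f \<longleftrightarrow>
     f \<in> borel_measurable unit_leb \<and> integrable unit_leb (\<lambda>t. (f t)\<^sup>2)"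

definition L2_eq :: "(real \<Rightarrow> real) \<Rightarrow> (real \<Rightarrow> real) \<Rightarrow> bool" where
  "L2_eq f g \<longleftrightarrow> sq_integrable f \<and> sq_integrable g \<and> (AE t in unit_leb. f t = g t)"

lemma L2_eq_refl_iff: "L2_eq f f \<longleftrightarrow> sq_integrable f"
  by (simp add: L2_eq_def)

lemma part_equivp_L2_eq: "part_equivp L2_eq"
proof (rule part_equivpI)
  have "sq_integrable (\<lambda>_. 0)" by (simp add: sq_integrable_def)
  then show "\<exists>f. L2_eq f f" by (auto simp: L2_eq_refl_iff)
  show "symp L2_eq" by (rule sympI) (auto simp: L2_eq_def)
  show "transp L2_eq" by (rule transpI) (auto simp: L2_eq_def)
qed

lemma sq_integrable_mult:
  assumes "sq_integrable f" "sq_integrable g"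
  shows "integrable unit_leb (\<lambda>t. f t * g t)"
proof (rule Bochner_Integration.integrable_bound)
  show "integrable unit_leb (\<lambda>t. (f t)\<^sup>2 + (g t)\<^sup>2)"
    using assms by (simp add: sq_integrable_def)
  show "(\<lambda>t. f t * g t) \<in> borel_measurable unit_leb"
    using assms by (auto simp: sq_integrable_def)
  have "\<bar>a * b\<bar> \<le> a\<^sup>2 + b\<^sup>2" for a b :: real
  proof -
    have "2 * (\<bar>a\<bar> * \<bar>b\<bar>) \<le> a\<^sup>2 + b\<^sup>2"
      using sum_squares_bound[of "\<bar>a\<bar>" "\<bar>b\<bar>"] by simp
    moreover have "0 \<le> \<bar>a\<bar> * \<bar>b\<bar>" by simp
    ultimately show ?thesis by (simp only: abs_mult)
  qed
  then show "AE t in unit_leb. norm (f t * g t) \<le> norm ((f t)\<^sup>2 + (g t)\<^sup>2)"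
    by (intro AE_I2) simp
qed

lemma sq_integrable_add:
  assumes "sq_integrable f" "sq_integrable g"
  shows "sq_integrable (\<lambda>t. f t + g t)"
  using assms sq_integrable_mult[OF assms]
  by (auto simp: sq_integrable_def power2_sum mult.assoc)

lemma sq_integrable_scale:
  assumes "sq_integrable f"
  shows "sq_integrable (\<lambda>t. c * f t)"
  using assms by (auto simp: sq_integrable_def power_mult_distrib)

lemma sq_integrable_integrable:
  assumes "sq_integrable f"
  shows "integrable unit_leb f"
proof -
  have "sq_integrable (\<lambda>_. 1)"
    by (simp add: sq_integrable_def finite_measure.integrable_const finite_measure_lebesgue_on)
  from sq_integrable_mult[OF assms this] show ?thesis by simp
qed

lemma L2_eq_add: "L2_eq f f' \<Longrightarrow> L2_eq g g' \<Longrightarrow> L2_eq (\<lambda>t. f t + g t) (\<lambda>t. f' t + g' t)"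
  unfolding L2_eq_def by (auto intro: sq_integrable_add)

lemma L2_eq_scale: "L2_eq f f' \<Longrightarrow> L2_eq (\<lambda>t. c * f t) (\<lambda>t. c * f' t)"
  unfolding L2_eq_def by (auto intro: sq_integrable_scale)

quotient_type L2 = "real \<Rightarrow> real" / partial: L2_eq
  by (rule part_equivp_L2_eq)

instantiation L2 :: real_inner
begin

lift_definition zero_L2 :: L2 is "\<lambda>_. 0"
  by (simp add: L2_eq_def sq_integrable_def)

lift_definition plus_L2 :: "L2 \<Rightarrow> L2 \<Rightarrow> L2" is "\<lambda>f g t. f t + g t"
  by (rule L2_eq_add)

lift_definition uminus_L2 :: "L2 \<Rightarrow> L2" is "\<lambda>f t. - f t"
  using L2_eq_scale[of _ _ "-1"] by simp

definition minus_L2 :: "L2 \<Rightarrow> L2 \<Rightarrow> L2" where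
  "minus_L2 x y = x + (- y)"

lift_definition scaleR_L2 :: "real \<Rightarrow> L2 \<Rightarrow> L2" is "\<lambda>c f t. c * f t"
  by (rule L2_eq_scale)

lift_definition inner_L2 :: "L2 \<Rightarrow> L2 \<Rightarrow> real" is "\<lambda>f g. LINT t|unit_leb. f t * g t"
  by (rule integral_cong_AE) (auto simp: L2_eq_def sq_integrable_def)

definition norm_L2 :: "L2 \<Rightarrow> real" where
  "norm_L2 x = sqrt (inner x x)"

definition sgn_L2 :: "L2 \<Rightarrow> L2" where
  "sgn_L2 x = inverse (norm x) *\<^sub>R x"

definition dist_L2 :: "L2 \<Rightarrow> L2 \<Rightarrow> real" where
  "dist_L2 x y = norm (x - y)"

definition uniformity_L2 :: "(L2 \<times> L2) filter" where
  "uniformity_L2 = (INF e\<in>{0 <..}. principal {(x, y). dist x y < e})"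

definition open_L2 :: "L2 set \<Rightarrow> bool" where
  "open_L2 S = (\<forall>x\<in>S. \<forall>\<^sub>F (x', y) in uniformity. x' = x \<longrightarrow> y \<in> S)"

instance
proof
  fix x y z :: L2 and a b :: real
  show "x + y + z = x + (y + z)"
    by transfer (auto simp: L2_eq_refl_iff add.assoc intro!: sq_integrable_add)
  show "x + y = y + x"
    by transfer (auto simp: L2_eq_refl_iff add.commute intro!: sq_integrable_add)
  show "0 + x = x" by transfer simp
  show "- x + x = 0" by transfer (simp add: L2_eq_def sq_integrable_def)
  show "x - y = x + - y" by (simp add: minus_L2_def)
  show "a *\<^sub>R (x + y) = a *\<^sub>R x + a *\<^sub>R y"
    by transfer (auto simp: L2_eq_refl_iff distrib_left intro!: sq_integrable_add sq_integrable_scale)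
  show "(a + b) *\<^sub>R x = a *\<^sub>R x + b *\<^sub>R x"
    by transfer (auto simp: L2_eq_refl_iff distrib_right intro!: sq_integrable_add sq_integrable_scale)
  show "a *\<^sub>R b *\<^sub>R x = (a * b) *\<^sub>R x"
    by transfer (auto simp: L2_eq_refl_iff mult.assoc intro!: sq_integrable_scale)
  show "1 *\<^sub>R x = x" by transfer simp
  show "sgn x = inverse (norm x) *\<^sub>R x" by (rule sgn_L2_def)
  show "dist x y = norm (x - y)" by (rule dist_L2_def)
  show "uniformity = (INF e\<in>{0 <..}. principal {(x, y::L2). dist x y < e})"
    by (rule uniformity_L2_def)
  show "open S = (\<forall>x\<in>S. \<forall>\<^sub>F (x', y) in uniformity. x' = x \<longrightarrow> y \<in> S)" for S :: "L2 set"
    by (rule open_L2_def)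
  show "inner x y = inner y x" by transfer (simp add: mult.commute)
  show "inner (x + y) z = inner x z + inner y z"
    by transfer (simp add: L2_eq_refl_iff distrib_right sq_integrable_mult)
  show "inner (a *\<^sub>R x) y = a * inner x y"
    by transfer (simp add: mult.assoc)
  show "0 \<le> inner x x" by transfer simp
  show "inner x x = 0 \<longleftrightarrow> x = 0"
  proof transfer
    fix f assume "L2_eq f f"
    then have f: "sq_integrable f" by (simp add: L2_eq_refl_iff)
    have "(LINT t|unit_leb. f t * f t) = 0 \<longleftrightarrow> (AE t in unit_leb. f t * f t = 0)"
      by (rule integral_nonneg_eq_0_iff_AE) (auto intro: sq_integrable_mult f)
    then show "(LINT t|unit_leb. f t * f t) = 0 \<longleftrightarrow> L2_eq f (\<lambda>_. 0)"
      using f by (simp add: L2_eq_def sq_integrable_def)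
  qed
  show "norm x = sqrt (inner x x)" by (rule norm_L2_def)
qed

end


section \<open>Absolutely continuous elements, point values and derivatives\<close>

definition abs_cont_on :: "real \<Rightarrow> real \<Rightarrow> (real \<Rightarrow> real) \<Rightarrow> bool" where
  "abs_cont_on lo hi f \<longleftrightarrow>
     (\<forall>\<epsilon>>0. \<exists>\<delta>>0. \<forall>(n::nat) a b.
        (\<forall>i<n. lo \<le> a i \<and> a i \<le> b i \<and> b i \<le> hi) \<longrightarrow>
        (\<forall>i<n. \<forall>j<n. i \<noteq> j \<longrightarrow> {a i<..<b i} \<inter> {a j<..<b j} = {}) \<longrightarrow>
        (\<Sum>i<n. b i - a i) < \<delta> \<longrightarrow>
        (\<Sum>i<n. \<bar>f (b i) - f (a i)\<bar>) < \<epsilon>)"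

definition is_ac_rep :: "L2 \<Rightarrow> (real \<Rightarrow> real) \<Rightarrow> bool" where
  "is_ac_rep x f \<longleftrightarrow> abs_cont_on 0 1 f \<and> (AE t in unit_leb. f t = rep_L2 x t)"

definition L2_abs_cont :: "L2 \<Rightarrow> bool" where
  "L2_abs_cont x \<longleftrightarrow> (\<exists>f. is_ac_rep x f)"

text \<open>The absolutely continuous representative is unique on the unit interval
  (\<open>is_ac_rep_unique\<close> below); off the unit interval its values are arbitrary.\<close>

definition ac_rep :: "L2 \<Rightarrow> real \<Rightarrow> real" where
  "ac_rep x = (SOME f. is_ac_rep x f)"

text \<open>\<open>has_L2_deriv x y\<close> says that the a.e. derivative \<open>x'\<close> of the absolutely continuous
  representative of \<open>x\<close> lies in \<open>L2\<close> and is the class \<open>y\<close>; so \<open>\<exists>y. has_L2_deriv x y\<close> expresses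
  \<open>x' \<in> L2\<close>.  Such a \<open>y\<close> is unique (\<open>has_L2_deriv_unique\<close>).\<close>

definition has_L2_deriv :: "L2 \<Rightarrow> L2 \<Rightarrow> bool" where
  "has_L2_deriv x y \<longleftrightarrow> L2_abs_cont x \<and>
     (AE t in unit_leb. (ac_rep x has_real_derivative rep_L2 y t) (at t within {0..1}))"

definition L2_deriv :: "L2 \<Rightarrow> L2" where
  "L2_deriv x = (THE y. has_L2_deriv x y)"

lemma abs_cont_on_imp_continuous_on:
  assumes "abs_cont_on lo hi f"
  shows "continuous_on {lo..hi} f"
  unfolding continuous_on_iff
proof (intro ballI allI impI)
  fix x \<epsilon> :: real assume x: "x \<in> {lo..hi}" and "\<epsilon> > 0"
  from assms[unfolded abs_cont_on_def, THEN spec, THEN mp, OF \<open>\<epsilon> > 0\<close>]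
  obtain \<delta> where \<delta>: "\<delta> > 0" and *: "\<forall>(n::nat) a b.
        (\<forall>i<n. lo \<le> a i \<and> a i \<le> b i \<and> b i \<le> hi) \<longrightarrow>
        (\<forall>i<n. \<forall>j<n. i \<noteq> j \<longrightarrow> {a i<..<b i} \<inter> {a j<..<b j} = {}) \<longrightarrow>
        (\<Sum>i<n. b i - a i) < \<delta> \<longrightarrow>
        (\<Sum>i<n. \<bar>f (b i) - f (a i)\<bar>) < \<epsilon>"
    by (elim exE conjE)
  have "dist (f y) (f x) < \<epsilon>" if "y \<in> {lo..hi}" "dist y x < \<delta>" for y
    using *[THEN spec[of _ 1], THEN spec[of _ "\<lambda>_. min x y"],
        THEN spec[of _ "\<lambda>_. max x y"]] that x
    by (cases "x \<le> y") (auto simp: dist_real_def)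
  with \<delta> show "\<exists>\<delta>>0. \<forall>y\<in>{lo..hi}. dist y x < \<delta> \<longrightarrow> dist (f y) (f x) < \<epsilon>"
    by blast
qed

lemma AE_unit_leb_continuous_eq:
  fixes f g :: "real \<Rightarrow> real"
  assumes f: "continuous_on {0..1} f" and g: "continuous_on {0..1} g"
    and ae: "AE t in unit_leb. f t = g t" and t: "t \<in> {0..1}"
  shows "f t = g t"
proof -
  define h where "h = (\<lambda>t. f t - g t)"
  have h: "continuous_on {0..1} h"
    unfolding h_def by (intro continuous_intros f g)
  let ?U = "{0<..<1} \<inter> h -` (- {0})"
  have "continuous_on {0<..<1} h"
    by (rule continuous_on_subset[OF h]) auto
  then have "open ?U"
    by (intro continuous_open_preimage) auto
  moreover have "negligible ?U"
  proof -
    have "AE t in lebesgue. t \<in> {0..1} \<longrightarrow> f t = g t"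
      using ae by (subst (asm) AE_restrict_space_iff) auto
    then obtain N where N: "N \<in> null_sets lebesgue"
        "{t \<in> space lebesgue. \<not> (t \<in> {0..1} \<longrightarrow> f t = g t)} \<subseteq> N"
      unfolding eventually_ae_filter by blast
    then have "negligible N" by (simp add: negligible_iff_null_sets)
    then show ?thesis
    proof (rule negligible_subset)
      have "?U \<subseteq> {t \<in> space lebesgue. \<not> (t \<in> {0..1} \<longrightarrow> f t = g t)}"
        by (auto simp: h_def)
      with N(2) show "?U \<subseteq> N" by (rule subset_trans[rotated])
    qed
  qed
  ultimately have "?U = {}" using open_not_negligible by blast
  then have z: "\<And>t. t \<in> {0<..<1} \<Longrightarrow> h t = 0" by auto
  have "h t = 0"
    by (rule continuous_constant_on_closure[of "{0<..<1}" h 0 t]) (use h t z in auto)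
  then show ?thesis by (simp add: h_def)
qed

lemma is_ac_rep_unique:
  assumes "is_ac_rep x f" "is_ac_rep x g" "t \<in> {0..1}"
  shows "f t = g t"
proof (rule AE_unit_leb_continuous_eq[of f g])
  show "continuous_on {0..1} f" "continuous_on {0..1} g"
    using assms by (auto simp: is_ac_rep_def intro: abs_cont_on_imp_continuous_on)
  have "AE t in unit_leb. f t = rep_L2 x t" "AE t in unit_leb. g t = rep_L2 x t"
    using assms by (auto simp: is_ac_rep_def)
  then show "AE t in unit_leb. f t = g t"
    by eventually_elim simp
  show "t \<in> {0..1}" by (rule assms(3))
qed

lemma rep_L2_AE_eqD:
  assumes "AE t in unit_leb. rep_L2 x t = rep_L2 y t"
  shows "x = y"
proof -
  have "L2_eq (rep_L2 z) (rep_L2 z)" for z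
    by (rule Quotient3_rep_reflp[OF Quotient3_L2])
  then have "L2_eq (rep_L2 x) (rep_L2 y)"
    using assms by (simp add: L2_eq_def)
  then show ?thesis
    by (simp add: Quotient3_rel_rep[OF Quotient3_L2])
qed

lemma has_L2_deriv_unique:
  assumes "has_L2_deriv x y" "has_L2_deriv x z"
  shows "y = z"
proof (rule rep_L2_AE_eqD)
  have u: "c = d" if "(f has_real_derivative c) (at t within {0..1})"
      "(f has_real_derivative d) (at t within {0..1})" "t \<in> {0..1}" for f c d and t :: real
    using that vector_derivative_unique_within_closed_interval[of 0 1 t f c d]
    by (simp add: has_real_derivative_iff_has_vector_derivative)
  from assms have
    "AE t in unit_leb. (ac_rep x has_real_derivative rep_L2 y t) (at t within {0..1})"
    "AE t in unit_leb. (ac_rep x has_real_derivative rep_L2 z t) (at t within {0..1})"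
    by (auto simp: has_L2_deriv_def)
  moreover have "AE t in unit_leb. t \<in> {0..1}"
    by (rule AE_I2) simp
  ultimately show "AE t in unit_leb. rep_L2 y t = rep_L2 z t"
    by eventually_elim (use u in blast)
qed

lemma L2_deriv_eq: "has_L2_deriv x y \<Longrightarrow> L2_deriv x = y"
  unfolding L2_deriv_def using has_L2_deriv_unique by blast


section \<open>The Volterra operator\<close>

lemma sq_integrable_indefinite_integral:
  assumes "integrable unit_leb f"
  shows "sq_integrable (\<lambda>t. LINT s|lebesgue_on {0..t}. f s)"
proof -
  let ?F = "\<lambda>t. LINT s|lebesgue_on {0..t}. f s"
  have c: "continuous_on {0..1} ?F"
    by (rule indefinite_integral_continuous_real[OF assms])
  then have "continuous_on {0..1} (\<lambda>t. (?F t)\<^sup>2)"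
    by (intro continuous_intros)
  then show ?thesis
    using c unfolding sq_integrable_def
    by (auto intro: continuous_imp_measurable_on_sets_lebesgue continuous_imp_integrable_real)
qed

text \<open>Representatives matter only on the unit interval; for \<open>t \<notin> {0..1}\<close> the values of the
  functions below are irrelevant.\<close>

lift_definition volterra :: "L2 \<Rightarrow> L2" is "\<lambda>f t. LINT s|lebesgue_on {0..t}. f s"
proof -
  fix f g assume fg: "L2_eq f g"
  then have i: "integrable unit_leb f" "integrable unit_leb g"
    by (auto simp: L2_eq_def intro: sq_integrable_integrable)
  have "(LINT s|lebesgue_on {0..t}. f s) = (LINT s|lebesgue_on {0..t}. g s)"
    if "t \<in> {0..1}" for t
  proof (rule integral_cong_AE)
    show "f \<in> borel_measurable (lebesgue_on {0..t})" "g \<in> borel_measurable (lebesgue_on {0..t})"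
      using i[THEN integrable_subinterval, of 0 t] that
      by (auto dest: borel_measurable_integrable)
    have "AE s in lebesgue. s \<in> {0..1} \<longrightarrow> f s = g s"
      using fg by (subst (asm) L2_eq_def, subst (asm) AE_restrict_space_iff) auto
    then have "AE s in lebesgue. s \<in> {0..t} \<longrightarrow> f s = g s"
      by eventually_elim (use that in auto)
    then show "AE s in lebesgue_on {0..t}. f s = g s"
      by (subst AE_restrict_space_iff) auto
  qed
  then show "L2_eq (\<lambda>t. LINT s|lebesgue_on {0..t}. f s) (\<lambda>t. LINT s|lebesgue_on {0..t}. g s)"
    using i by (auto simp: L2_eq_def intro!: sq_integrable_indefinite_integral AE_I2)
qed

text \<open>The library's Hilbert-space \<open>adjoint\<close> is a choice of some adjoint; the following
  lemma shows that for the Volterra operator one exists and is the expected integral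
  operator, which by \<open>adjoint_unique\<close> is therefore \<open>adjoint volterra\<close>.\<close>

lemma integral_lebesgue_on_subset:
  fixes f :: "real \<Rightarrow> real"
  assumes "{a..b} \<subseteq> {0..1}"
  shows "(LINT s|lebesgue_on {a..b}. f s) = (LINT s|unit_leb. indicator {a..b} s * f s)"
proof -
  have "(\<lambda>s. indicator {0..1} s *\<^sub>R (indicator {a..b} s * f s)) = (\<lambda>s. indicator {a..b} s *\<^sub>R f s)"
    using assms by (auto simp: indicator_def fun_eq_iff)
  then show ?thesis
    by (simp only: integral_restrict_space lborelD_Collect sets_completionI_sets sets_lborel
        borel_closed closed_atLeastAtMost Int_UNIV_right space_completion space_lborel space_borel)
qed

lemma volterra_Fubini:
  fixes f g :: "real \<Rightarrow> real"
  assumes f: "integrable unit_leb f" and g: "integrable unit_leb g"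
  shows "(LINT t|unit_leb. (LINT s|lebesgue_on {0..t}. f s) * g t) =
         (LINT s|unit_leb. f s * (LINT t|lebesgue_on {s..1}. g t))"
proof -
  interpret finite_measure unit_leb by (rule finite_measure_lebesgue_on) simp
  interpret P: pair_sigma_finite unit_leb unit_leb ..
  let ?h = "\<lambda>t s. indicator {s. s \<le> t} s * (f s * g t) :: real"
  have fm [measurable]: "f \<in> borel_measurable unit_leb" "g \<in> borel_measurable unit_leb"
    using f g by auto
  have idm [measurable]: "(\<lambda>x. x) \<in> borel_measurable unit_leb"
    by (intro measurable_restrict_space1 measurable_completion) simp
  have prod: "integrable (unit_leb \<Otimes>\<^sub>M unit_leb) (\<lambda>(t, s). f s * g t)"
  proof (rule P.Fubini_integrable)
    show "(\<lambda>(t, s). f s * g t) \<in> borel_measurable (unit_leb \<Otimes>\<^sub>M unit_leb)"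
      by measurable
    show "integrable unit_leb (\<lambda>t. LINT s|unit_leb. norm (case (t, s) of (t, s) \<Rightarrow> f s * g t))"
      using g by (simp add: abs_mult)
    show "AE t in unit_leb. integrable unit_leb (\<lambda>s. case (t, s) of (t, s) \<Rightarrow> f s * g t)"
      using f by simp
  qed
  have h: "integrable (unit_leb \<Otimes>\<^sub>M unit_leb) (\<lambda>(t, s). ?h t s)"
  proof (rule Bochner_Integration.integrable_bound[OF prod])
    have "(\<lambda>(t, s). (if s \<le> t then f s * g t else 0)) \<in> borel_measurable (unit_leb \<Otimes>\<^sub>M unit_leb)"
      by measurable
    also have "(\<lambda>(t, s). (if s \<le> t then f s * g t else 0)) = (\<lambda>(t, s). ?h t s)"
      by (auto simp: indicator_def)
    finally show "(\<lambda>(t, s). ?h t s) \<in> borel_measurable (unit_leb \<Otimes>\<^sub>M unit_leb)" .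
  qed (auto simp: indicator_def)
  have "(LINT t|unit_leb. (LINT s|lebesgue_on {0..t}. f s) * g t) =
        (LINT t|unit_leb. LINT s|unit_leb. ?h t s)"
  proof (rule Bochner_Integration.integral_cong)
    fix t :: real assume "t \<in> space unit_leb"
    then have "(LINT s|lebesgue_on {0..t}. f s) * g t =
               (LINT s|unit_leb. indicator {0..t} s * f s * g t)"
      by (subst integral_lebesgue_on_subset) auto
    also have "\<dots> = (LINT s|unit_leb. ?h t s)"
      by (rule Bochner_Integration.integral_cong) (auto simp: indicator_def)
    finally show "(LINT s|lebesgue_on {0..t}. f s) * g t = (LINT s|unit_leb. ?h t s)" .
  qed simp
  also have "\<dots> = (LINT s|unit_leb. LINT t|unit_leb. ?h t s)"
    using P.Fubini_integral[OF h] by simp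
  also have "\<dots> = (LINT s|unit_leb. f s * (LINT t|lebesgue_on {s..1}. g t))"
  proof (rule Bochner_Integration.integral_cong)
    fix s :: real assume s: "s \<in> space unit_leb"
    then have "f s * (LINT t|lebesgue_on {s..1}. g t) =
               (LINT t|unit_leb. f s * (indicator {s..1} t * g t))"
      by (subst integral_lebesgue_on_subset) auto
    also have "\<dots> = (LINT t|unit_leb. ?h t s)"
      by (rule Bochner_Integration.integral_cong) (auto simp: indicator_def)
    finally show "(LINT t|unit_leb. ?h t s) = f s * (LINT t|lebesgue_on {s..1}. g t)" by simp
  qed simp
  finally show ?thesis .
qed

lemma integral_lebesgue_on_upper:
  fixes f :: "real \<Rightarrow> real"
  assumes f: "integrable unit_leb f" and t: "t \<in> {0..1}"
  shows "(LINT s|lebesgue_on {t..1}. f s) = (LINT s|unit_leb. f s) - (LINT s|lebesgue_on {0..t}. f s)"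
proof -
  have i: "f integrable_on {0..1}" "integrable (lebesgue_on {0..t}) f" "integrable (lebesgue_on {t..1}) f"
    using f integrable_subinterval[OF f, of 0 t] integrable_subinterval[OF f, of t 1] t
    by (auto simp: integrable_on_lebesgue_on)
  show ?thesis
    using Henstock_Kurzweil_Integration.integral_combine[of 0 t 1 f] i f t
    by (simp add: lebesgue_integral_eq_integral)
qed

lift_definition volterra_adj :: "L2 \<Rightarrow> L2" is "\<lambda>f t. LINT s|lebesgue_on {t..1}. f s"
proof -
  fix f g assume fg: "L2_eq f g"
  then have i: "integrable unit_leb f" "integrable unit_leb g"
    by (auto simp: L2_eq_def intro: sq_integrable_integrable)
  let ?U = "\<lambda>f t. LINT s|lebesgue_on {t..1}. (f s :: real)"
  let ?L = "\<lambda>f t. (LINT s|unit_leb. f s) + - (LINT s|lebesgue_on {0..t}. (f s :: real))"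
  have eq: "?U h t = ?L h t" if "integrable unit_leb h" "t \<in> {0..1}" for h t
    unfolding add_uminus_conv_diff using that by (rule integral_lebesgue_on_upper)
  have sq: "sq_integrable (?U h)" if h: "integrable unit_leb h" for h
  proof -
    have "sq_integrable (\<lambda>_. LINT s|unit_leb. h s)"
      by (simp add: sq_integrable_def finite_measure.integrable_const finite_measure_lebesgue_on)
    moreover have "sq_integrable (\<lambda>t. - (LINT s|lebesgue_on {0..t}. h s))"
      using sq_integrable_scale[OF sq_integrable_indefinite_integral[OF h], of "-1"] by simp
    ultimately have L: "sq_integrable (?L h)" by (rule sq_integrable_add)
    have "?U h \<in> borel_measurable unit_leb \<longleftrightarrow> ?L h \<in> borel_measurable unit_leb"
      by (rule measurable_cong) (rule eq[OF h], simp)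
    moreover have "integrable unit_leb (\<lambda>t. (?U h t)\<^sup>2) \<longleftrightarrow> integrable unit_leb (\<lambda>t. (?L h t)\<^sup>2)"
      by (rule Bochner_Integration.integrable_cong[OF refl], rule arg_cong[where f="\<lambda>x. x\<^sup>2"],
          rule eq[OF h], simp)
    ultimately show ?thesis using L by (simp add: sq_integrable_def)
  qed
  have "L2_eq (\<lambda>t. LINT s|lebesgue_on {0..t}. f s) (\<lambda>t. LINT s|lebesgue_on {0..t}. g s)"
    using fg by (rule volterra.rsp[unfolded rel_fun_def, rule_format])
  then have ae: "AE t in unit_leb. (LINT s|lebesgue_on {0..t}. f s) = (LINT s|lebesgue_on {0..t}. g s)"
    by (simp add: L2_eq_def)
  have c: "(LINT s|unit_leb. f s) = (LINT s|unit_leb. g s)"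
    using fg by (intro integral_cong_AE) (auto simp: L2_eq_def sq_integrable_def)
  have "AE t in unit_leb. t \<in> {0..1}"
    by (rule AE_I2) simp
  with ae have "AE t in unit_leb. ?U f t = ?U g t"
  proof eventually_elim
    case (elim t)
    have "?U f t = ?L f t" using i(1) elim(2) by (rule eq)
    also have "\<dots> = ?L g t" unfolding elim(1) c ..
    also have "\<dots> = ?U g t" using eq[OF i(2) elim(2)] by (rule sym)
    finally show ?case .
  qed
  then show "L2_eq (?U f) (?U g)"
    using sq i by (simp add: L2_eq_def)
qed

lemma adjoint_volterra: "adjoint volterra = volterra_adj"
proof (rule adjoint_unique, intro allI)
  fix x y
  show "inner (volterra x) y = inner x (volterra_adj y)"
    by transfer (simp add: L2_eq_refl_iff volterra_Fubini sq_integrable_integrable)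
qed


section \<open>The operators of the theorem\<close>

definition V_circ :: "L2 \<Rightarrow> L2" where
  "V_circ x = (volterra x - adjoint volterra x) /\<^sub>R 2"

definition T2 :: "L2 \<Rightarrow> L2 set" where
  "T2 = op_inverse (op_of_fun V_circ)"

end

theory Submission
  imports Defs
begin

text \<open>The theorem splits into a Hilbert space part and a real analysis part.

  The operator \<open>V_circ\<close> is skew-adjoint because the Volterra operator and its adjoint are swapped
  by the adjoint: \<open>\<langle>V_circ u, w\<rangle> = - \<langle>u, V_circ w\<rangle>\<close> (\<open>V_circ_skew\<close>).  For an everywhere defined
  skew-adjoint \<open>S\<close> on any real inner product space, the inverse relation, with graph
  \<open>{(S u, u) | u}\<close>, has all the properties of part (ii): skewness is
  \<open>\<langle>S u, u\<rangle> = - \<langle>S u, u\<rangle>\<close>; the adjoint is read off from the definition of the orthogonal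
  complement; and maximality holds because a pair \<open>(S u + z, u)\<close> that is monotonically
  related to \<open>(S (u + z), u + z)\<close> satisfies \<open>- \<parallel>z\<parallel>\<^sup>2 \<ge> 0\<close>.  The negative of the inverse is the
  inverse of the skew-adjoint operator \<open>- S\<close>, so it has the same properties.

  Part (i) amounts to the equivalence \<open>V_circ_eq_iff\<close>.  Since the integrals of \<open>y\<close> over
  \<open>{0..t}\<close> and \<open>{t..1}\<close> add up to the total integral \<open>I\<close>, the class \<open>V_circ y\<close> is represented by
  \<open>G t = \<integral>\<^sub>0\<^sup>t y - I / 2\<close>, an antiderivative of \<open>y\<close> normalised so that \<open>G 0 = - G 1\<close>.
  That \<open>G\<close> is absolutely continuous with derivative \<open>y\<close> almost everywhere is Lebesgue's
  differentiation theorem on the line (\<open>indefinite_integral_has_real_derivative_AE\<close>) together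
  with \<open>abs_cont_on_indefinite_integral\<close>.  Conversely an absolutely continuous function is
  recovered from its almost everywhere derivative up to a constant
  (\<open>abs_cont_on_has_integral\<close>), and the condition \<open>x(0) = - x(1)\<close> determines that constant.\<close>

section \<open>Inverses of skew-adjoint operators\<close>

lemma gra_inverse_fun: "gra (op_inverse (op_of_fun S)) = {(S u, u) |u. True}"
  by (auto simp: gra_def op_inverse_def op_of_fun_def)

text \<open>A map with a formal adjoint is linear: its value at \<open>u\<close> is determined by inner products
  in which \<open>u\<close> occurs linearly.\<close>

lemma linear_of_skew:
  fixes S :: "'a::real_inner \<Rightarrow> 'a"
  assumes skew: "\<And>u w. inner (S u) w = - inner u (S w)"
  shows "linear S"
proof (rule linearI)
  show "S (u + v) = S u + S v" for u v
  proof (rule vector_eq_rdot[THEN iffD1], intro allI)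
    show "inner (S (u + v)) w = inner (S u + S v) w" for w
      by (simp add: skew inner_add_left)
  qed
  show "S (c *\<^sub>R u) = c *\<^sub>R S u" for c u
  proof (rule vector_eq_rdot[THEN iffD1], intro allI)
    show "inner (S (c *\<^sub>R u)) w = inner (c *\<^sub>R S u) w" for w
      by (simp add: skew)
  qed
qed

lemma skew_op_inverse:
  fixes S :: "'a::real_inner \<Rightarrow> 'a"
  assumes skew: "\<And>u w. inner (S u) w = - inner u (S w)"
  shows "skew_op (op_inverse (op_of_fun S))"
proof -
  interpret linear S using skew by (rule linear_of_skew)
  have "gra (op_inverse (op_of_fun S)) = range (\<lambda>u. (S u, u))"
    by (auto simp: gra_inverse_fun)
  moreover have "linear (\<lambda>u. (S u, u))"
    by (rule linearI) (simp_all add: add scale)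
  ultimately have "subspace (gra (op_inverse (op_of_fun S)))"
    by (simp add: linear_subspace_image)
  moreover have "inner (S u) u = 0" for u
    using skew[of u u] by (simp add: inner_commute)
  ultimately show ?thesis
    by (auto simp: skew_op_def linear_relation_def gra_inverse_fun)
qed

text \<open>The pair \<open>(S u, - u)\<close> is also \<open>(- S (- u), - u)\<close>, as \<open>S\<close> is odd.  Statements about the
  inverse of a skew-adjoint map therefore carry over to the negative of that inverse.\<close>

lemma op_uminus_inverse_fun:
  assumes skew: "\<And>u w. inner (S u) w = - inner u (S w)"
  shows "op_uminus (op_inverse (op_of_fun S)) = op_inverse (op_of_fun (\<lambda>u. - S u))"
proof -
  have neg: "S (- u) = - S u" for u
    using linear_of_skew[of S, OF skew] by (rule linear_neg)
  have "(\<exists>v. x = S v \<and> u = - v) \<longleftrightarrow> x = - S u" for x u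
    by (auto simp: neg intro!: exI[of _ "- u"])
  then have "uminus ` {v. x = S v} = {u. x = - S u}" for x
    by (intro set_eqI) (unfold image_iff Bex_def mem_Collect_eq)
  then show ?thesis
    by (simp add: op_uminus_def op_inverse_def op_of_fun_def gra_def)
qed

text \<open>A pair \<open>(x, u)\<close> in a monotone extension is tested against the graph element over
  \<open>u + z\<close>, where \<open>z = x - S u\<close> is the defect of \<open>(x, u)\<close>.  By skewness the monotonicity
  inequality collapses to \<open>0 \<le> - \<parallel>z\<parallel>\<^sup>2\<close>.\<close>

lemma maximal_monotone_op_inverse:
  fixes S :: "'a::real_inner \<Rightarrow> 'a"
  assumes skew: "\<And>u w. inner (S u) w = - inner u (S w)"
  shows "maximal_monotone_op (op_inverse (op_of_fun S))"
proof -
  interpret linear S using skew by (rule linear_of_skew)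
  have null: "inner (S u) u = 0" for u
    using skew[of u u] by (simp add: inner_commute)
  have "inner (S u - S v) (u - v) = 0" for u v
    using null[of "u - v"] by (simp add: diff)
  then have mono: "monotone_op (op_inverse (op_of_fun S))"
    by (auto simp: monotone_op_def gra_inverse_fun)
  have False if B: "monotone_op B" and sub: "gra (op_inverse (op_of_fun S)) \<subset> gra B" for B
  proof -
    obtain x u where xu: "(x, u) \<in> gra B" "(x, u) \<notin> gra (op_inverse (op_of_fun S))"
      using sub by auto
    define z where "z = x - S u"
    have "0 \<le> inner (x - S (u + z)) (u - (u + z))"
      using B xu(1) sub unfolding monotone_op_def gra_inverse_fun by fast
    also have "x - S (u + z) = z - S z"
      by (simp add: z_def add)
    also have "inner (z - S z) (u - (u + z)) = - inner z z"
      using null[of z] by (simp add: inner_diff_left)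
    finally have "z = 0" by (metis inner_ge_zero inner_eq_zero_iff neg_0_le_iff_le order_antisym)
    then show False using xu(2) by (auto simp: z_def gra_inverse_fun)
  qed
  with mono show ?thesis by (auto simp: maximal_monotone_op_def)
qed

text \<open>Orthogonality of \<open>(u, - x)\<close> to every \<open>(S w, w)\<close> says \<open>\<langle>w, - S u\<rangle> = \<langle>w, x\<rangle>\<close> for all \<open>w\<close>.\<close>

lemma adjoint_op_inverse:
  fixes S :: "'a::real_inner \<Rightarrow> 'a"
  assumes skew: "\<And>u w. inner (S u) w = - inner u (S w)"
  shows "op_adjoint (op_inverse (op_of_fun S)) = op_uminus (op_inverse (op_of_fun S))"
proof -
  have "u \<in> op_adjoint (op_inverse (op_of_fun S)) x \<longleftrightarrow> - S u = x" for x u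
  proof -
    have "u \<in> op_adjoint (op_inverse (op_of_fun S)) x \<longleftrightarrow> (\<forall>w. inner w (- S u) = inner w x)"
      by (auto simp: op_adjoint_def orthogonal_comp_def orthogonal_def gra_inverse_fun skew)
    then show ?thesis by (simp only: vector_eq_ldot)
  qed
  then show ?thesis
    unfolding op_uminus_inverse_fun[of S, OF skew]
    by (auto simp: fun_eq_iff op_inverse_def op_of_fun_def gra_def)
qed

section \<open>Differentiation of indefinite integrals\<close>

text \<open>Lebesgue's differentiation theorem on an interval.  The proposition
  \<open>integrable_ccontinuous_explicit\<close> shows that averages over small cubes with lower corner \<open>x\<close> tend to
  \<open>f x\<close>, which on the line gives the right derivative outside a null set; applied to the reflected function
  it gives the left derivative.\<close>

lemma indefinite_integral_has_real_derivative_AE: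
  fixes f :: "real \<Rightarrow> real"
  assumes f: "f integrable_on {a..b}"
  obtains N where "negligible N"
    "\<And>x. x \<in> {a..b} - N \<Longrightarrow>
       ((\<lambda>t. integral {a..t} f) has_real_derivative f x) (at x within {a..b})"
proof -
  define g where "g = (\<lambda>x. if x \<in> {a..b} then f x else 0)"
  have "g integrable_on UNIV"
    using f unfolding g_def by (simp only: integrable_restrict_UNIV)
  then have g: "g integrable_on cbox c d" for c d
    by (rule integrable_on_subcbox) simp
  have gr: "(\<lambda>x. g (- x)) integrable_on cbox c d" for c d
    using g[of "-d" "-c"] Henstock_Kurzweil_Integration.integrable_reflect_real[where f=g and a="- d" and b="- c"] by simp
  obtain N1 where N1: "negligible N1"
    and right: "\<And>x e. x \<notin> N1 \<Longrightarrow> 0 < e \<Longrightarrow>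
      \<exists>d>0. \<forall>h. 0 < h \<and> h < d \<longrightarrow> \<bar>integral {x..x + h} g / h - g x\<bar> < e"
    by (rule integrable_ccontinuous_explicit[of g, OF g]) (auto simp: divide_inverse_commute)
  obtain N2 where N2: "negligible N2"
    and left: "\<And>x e. x \<notin> N2 \<Longrightarrow> 0 < e \<Longrightarrow>
      \<exists>d>0. \<forall>h. 0 < h \<and> h < d \<longrightarrow> \<bar>integral {x..x + h} (\<lambda>t. g (- t)) / h - g (- x)\<bar> < e"
    by (rule integrable_ccontinuous_explicit[of "\<lambda>t. g (- t)", OF gr]) (auto simp: divide_inverse_commute)
  show thesis
  proof
    show "negligible (N1 \<union> uminus ` N2)"
      using N1 negligible_differentiable_image_negligible[OF _ N2, of uminus]
      by (auto simp: differentiable_on_def)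
    fix x assume x: "x \<in> {a..b} - (N1 \<union> uminus ` N2)"
    then have xN: "x \<notin> N1" "- x \<notin> N2" by force+
    have F: "integral {a..d} f - integral {a..c} f = integral {c..d} g"
      if "a \<le> c" "c \<le> d" "d \<le> b" for c d
    proof -
      have "f integrable_on {a..d}"
        using f that by (auto intro: integrable_subinterval_real)
      from Henstock_Kurzweil_Integration.integral_combine[OF that(1,2) this]
      have "integral {a..d} f - integral {a..c} f = integral {c..d} f" by simp
      also have "\<dots> = integral {c..d} g"
        by (rule integral_cong) (use that in \<open>auto simp: g_def\<close>)
      finally show ?thesis .
    qed
    show "((\<lambda>t. integral {a..t} f) has_real_derivative f x) (at x within {a..b})"
      unfolding has_field_derivative_iff Lim_within
    proof (intro allI impI)
      fix e :: real assume "e > 0"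
      from right[OF xN(1) this] obtain d1 where d1: "d1 > 0"
        "\<And>h. 0 < h \<Longrightarrow> h < d1 \<Longrightarrow> \<bar>integral {x..x + h} g / h - g x\<bar> < e" by blast
      from left[OF xN(2) \<open>e > 0\<close>] obtain d2 where d2: "d2 > 0"
        "\<And>h. 0 < h \<Longrightarrow> h < d2 \<Longrightarrow> \<bar>integral {- x..- x + h} (\<lambda>t. g (- t)) / h - g x\<bar> < e" by auto
      have "dist ((integral {a..y} f - integral {a..x} f) / (y - x)) (f x) < e"
        if y: "y \<in> {a..b}" "0 < dist y x" "dist y x < min d1 d2" for y
      proof (cases "x < y")
        case True
        then show ?thesis
          using d1(2)[of "y - x"] F[of x y] x y by (auto simp: g_def dist_real_def)
      next
        case False
        with y have "y < x" by (auto simp: dist_real_def)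
        moreover have "integral {- x..- y} (\<lambda>t. g (- t)) = integral {y..x} g"
          by (rule Henstock_Kurzweil_Integration.integral_reflect_real)
        moreover have "(integral {a..y} f - integral {a..x} f) / (y - x)
            = (integral {a..x} f - integral {a..y} f) / (x - y)"
          by (metis minus_diff_eq minus_divide_divide)
        ultimately show ?thesis
          using d2(2)[of "x - y"] F[of y x] x y by (auto simp: g_def dist_real_def)
      qed
      then show "\<exists>d>0. \<forall>y\<in>{a..b}. 0 < dist y x \<and> dist y x < d \<longrightarrow>
          dist ((integral {a..y} f - integral {a..x} f) / (y - x)) (f x) < e"
        using d1(1) d2(1) by (intro exI[of _ "min d1 d2"]) auto
    qed
  qed
qed

section \<open>Absolutely continuous functions\<close>

text \<open>The definition enumerates the intervals by natural numbers below \<open>n\<close>; the parts of a tagged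
  division come as a finite set without an enumeration.\<close>

lemma abs_cont_onE:
  assumes "abs_cont_on lo hi f" "\<epsilon> > 0"
  obtains \<delta> where "\<delta> > 0"
    "\<And>(I :: 'i set) a b. finite I \<Longrightarrow> (\<And>i. i \<in> I \<Longrightarrow> lo \<le> a i \<and> a i \<le> b i \<and> b i \<le> hi) \<Longrightarrow>
       disjoint_family_on (\<lambda>i. {a i<..<b i}) I \<Longrightarrow> (\<Sum>i\<in>I. b i - a i) < \<delta> \<Longrightarrow>
       (\<Sum>i\<in>I. \<bar>f (b i) - f (a i)\<bar>) < \<epsilon>"
proof -
  obtain \<delta> where \<delta>: "\<delta> > 0" and *: "\<And>(n::nat) a b.
        (\<forall>i<n. lo \<le> a i \<and> a i \<le> b i \<and> b i \<le> hi) \<Longrightarrow>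
        (\<forall>i<n. \<forall>j<n. i \<noteq> j \<longrightarrow> {a i<..<b i} \<inter> {a j<..<b j} = {}) \<Longrightarrow>
        (\<Sum>i<n. b i - a i) < \<delta> \<Longrightarrow>
        (\<Sum>i<n. \<bar>f (b i) - f (a i)\<bar>) < \<epsilon>"
    using assms(1)[unfolded abs_cont_on_def, THEN spec, THEN mp, OF assms(2)] by blast
  show thesis
  proof
    show "\<delta> > 0" by (rule \<delta>)
    fix I :: "'i set" and a b
    assume I: "finite I" "\<And>i. i \<in> I \<Longrightarrow> lo \<le> a i \<and> a i \<le> b i \<and> b i \<le> hi"
      "disjoint_family_on (\<lambda>i. {a i<..<b i}) I" "(\<Sum>i\<in>I. b i - a i) < \<delta>"
    obtain h where h: "bij_betw h {..<card I} I"
      using ex_bij_betw_nat_finite[OF I(1)] by (auto simp: atLeast0LessThan)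
    have hI: "h i \<in> I" if "i < card I" for i
      using h that by (auto simp: bij_betw_def)
    have hd: "h i \<noteq> h j" if "i < card I" "j < card I" "i \<noteq> j" for i j
      using h that by (auto simp: bij_betw_def inj_on_def)
    have "(\<Sum>i<card I. \<bar>f (b (h i)) - f (a (h i))\<bar>) < \<epsilon>"
    proof (rule *)
      show "\<forall>i<card I. \<forall>j<card I. i \<noteq> j \<longrightarrow> {a (h i)<..<b (h i)} \<inter> {a (h j)<..<b (h j)} = {}"
        using I(3) hI hd unfolding disjoint_family_on_def by blast
      show "(\<Sum>i<card I. b (h i) - a (h i)) < \<delta>"
        using I(4) sum.reindex_bij_betw[OF h, of "\<lambda>i. b i - a i"] by simp
    qed (use I(2) hI in blast)
    then show "(\<Sum>i\<in>I. \<bar>f (b i) - f (a i)\<bar>) < \<epsilon>"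
      using sum.reindex_bij_betw[OF h, of "\<lambda>i. \<bar>f (b i) - f (a i)\<bar>"] by simp
  qed
qed

lemma abs_cont_on_subinterval:
  assumes "abs_cont_on lo hi f" "lo \<le> c" "d \<le> hi"
  shows "abs_cont_on c d f"
  unfolding abs_cont_on_def
proof (intro allI impI)
  fix e :: real assume "e > 0"
  from assms(1)[unfolded abs_cont_on_def, THEN spec, THEN mp, OF this]
  obtain \<delta> where \<delta>: "\<delta> > 0" and bound: "\<And>(n::nat) a b.
        (\<forall>i<n. lo \<le> a i \<and> a i \<le> b i \<and> b i \<le> hi) \<Longrightarrow>
        (\<forall>i<n. \<forall>j<n. i \<noteq> j \<longrightarrow> {a i<..<b i} \<inter> {a j<..<b j} = {}) \<Longrightarrow>
        (\<Sum>i<n. b i - a i) < \<delta> \<Longrightarrow> (\<Sum>i<n. \<bar>f (b i) - f (a i)\<bar>) < e"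
    by blast
  have sub: "\<forall>i<n. lo \<le> a i \<and> a i \<le> b i \<and> b i \<le> hi"
    if "\<forall>i<n. c \<le> a i \<and> a i \<le> b i \<and> b i \<le> d" for n :: nat and a b
    using that assms(2,3) order_trans by blast
  show "\<exists>\<delta>>0. \<forall>(n::nat) a b. (\<forall>i<n. c \<le> a i \<and> a i \<le> b i \<and> b i \<le> d) \<longrightarrow>
      (\<forall>i<n. \<forall>j<n. i \<noteq> j \<longrightarrow> {a i<..<b i} \<inter> {a j<..<b j} = {}) \<longrightarrow>
      (\<Sum>i<n. b i - a i) < \<delta> \<longrightarrow> (\<Sum>i<n. \<bar>f (b i) - f (a i)\<bar>) < e"
    by (rule exI[of _ \<delta>], rule conjI[OF \<delta>], (rule allI)+, (rule impI)+, rule bound[OF sub])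
qed

text \<open>The fundamental theorem of calculus for absolutely continuous functions, in the sense of
  the gauge integral.  On an interval whose tag is a point of differentiability, a fine gauge
  makes the increment of \<open>f\<close> differ from \<open>g x\<close> times the length by at most \<open>c\<close> times the
  length, so these errors add up to at most \<open>c (b - a)\<close>.  The intervals with tag in the
  exceptional null set are forced by the gauge into an open set of small measure, and absolute
  continuity makes the increments of \<open>f\<close> over them add up to less than any given bound.\<close>

lemma abs_cont_on_has_integral:
  assumes ac: "abs_cont_on a b f" and ab: "a \<le> b" and N: "negligible N"
    and der: "\<And>x. x \<in> {a..b} - N \<Longrightarrow> (f has_real_derivative g x) (at x within {a..b})"
  shows "(g has_integral (f b - f a)) {a..b}"
proof -
  \<comment> \<open>On \<open>N\<close> the values of \<open>g\<close> are arbitrary; setting them to 0 removes them from the Riemann sums.\<close>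
  define g0 where "g0 = (\<lambda>x. if x \<in> N then 0 else g x)"
  have "(g0 has_integral (f b - f a)) {a..b}"
    unfolding has_integral_real
  proof (intro allI impI)
    fix e :: real assume "e > 0"
    \<comment> \<open>The \<open>+ 1\<close> keeps the denominator positive when \<open>a = b\<close>.\<close>
    define c where "c = e / (2 * (b - a + 1))"
    have c: "c > 0" "c * (b - a) < e / 2"
      using \<open>e > 0\<close> ab by (auto simp: c_def field_simps)
    obtain \<delta> where \<delta>: "\<delta> > 0"
      and small: "\<And>(I :: (real \<times> real set) set) u v. finite I \<Longrightarrow> (\<And>i. i \<in> I \<Longrightarrow> a \<le> u i \<and> u i \<le> v i \<and> v i \<le> b) \<Longrightarrow>
        disjoint_family_on (\<lambda>i. {u i<..<v i}) I \<Longrightarrow> (\<Sum>i\<in>I. v i - u i) < \<delta> \<Longrightarrow>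
        (\<Sum>i\<in>I. \<bar>f (v i) - f (u i)\<bar>) < e / 2"
      by (rule abs_cont_onE[OF ac half_gt_zero[OF \<open>e > 0\<close>]]) blast
    have "N \<in> lmeasurable" "measure lebesgue N = 0"
      using N by (auto simp: negligible_iff_measure)
    moreover from this obtain T where T: "open T" "N \<subseteq> T" "T - N \<in> lmeasurable"
      "emeasure lebesgue (T - N) < ennreal \<delta>"
      using sets_lebesgue_outer_open[of N \<delta>] \<delta> by blast
    moreover have "measure lebesgue (T - N) < \<delta>"
      using T(3,4) by (simp add: emeasure_eq_measure2 ennreal_less_iff)
    moreover have "(T - N) \<union> N = T" using T(2) by blast
    ultimately have mT: "T \<in> lmeasurable" "measure lebesgue T < \<delta>"
      using measure_Un_le[of "T - N" lebesgue N] fmeasurable.Un[of "T - N" lebesgue N] by auto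
    have "\<exists>d>0. \<forall>y\<in>{a..b}. \<bar>y - x\<bar> < d \<longrightarrow> \<bar>f y - f x - g x * (y - x)\<bar> \<le> c * \<bar>y - x\<bar>"
      if "x \<in> {a..b} - N" for x
      using der[OF that] c(1) unfolding has_field_derivative_def has_derivative_within_alt
      by (auto simp: mult.commute)
    then obtain d where d: "\<And>x. x \<in> {a..b} - N \<Longrightarrow> d x > 0"
      and lin: "\<And>x y. x \<in> {a..b} - N \<Longrightarrow> y \<in> {a..b} \<Longrightarrow> \<bar>y - x\<bar> < d x \<Longrightarrow>
        \<bar>f y - f x - g x * (y - x)\<bar> \<le> c * \<bar>y - x\<bar>"
      by metis
    define \<gamma> where "\<gamma> = (\<lambda>x. if x \<in> N then T else if x \<in> {a..b} then ball x (d x) else ball x 1)"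
    have gauge: "gauge \<gamma>"
      using T d by (auto simp: gauge_def \<gamma>_def)
    have bound: "norm ((\<Sum>(x, K)\<in>p. measure lborel K *\<^sub>R g0 x) - (f b - f a)) < e"
      if p: "p tagged_division_of {a..b}" and fine: "\<gamma> fine p" for p
    proof -
      have fin: "finite p" using p by blast
      have K: "K = {Inf K..Sup K} \<and> Inf K \<le> x \<and> x \<le> Sup K \<and> a \<le> Inf K \<and> Sup K \<le> b
          \<and> measure lborel K = Sup K - Inf K \<and> K \<subseteq> \<gamma> x"
        if xK: "(x, K) \<in> p" for x K
      proof -
        have "x \<in> K" "K \<subseteq> {a..b}" "\<exists>u v. K = cbox u v"
          using tagged_division_ofD(2-4)[OF p xK] by auto
        then obtain u v where "K = {u..v}" "x \<in> {u..v}" "{u..v} \<subseteq> {a..b}" by auto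
        moreover have "K \<subseteq> \<gamma> x" using fine xK by (auto simp: fine_def)
        ultimately show ?thesis by (auto simp: content_real)
      qed
      have disj: "disjoint_family_on (\<lambda>(x, K). {Inf K<..<Sup K}) p"
        unfolding disjoint_family_on_def
      proof (intro ballI impI)
        fix i j assume ij: "i \<in> p" "j \<in> p" "i \<noteq> j"
        obtain x K y L where [simp]: "i = (x, K)" "j = (y, L)" by fastforce
        have xK: "(x, K) \<in> p" "(y, L) \<in> p" using ij by simp_all
        then have "interior K = {Inf K<..<Sup K}" "interior L = {Inf L<..<Sup L}"
          using K[of x K] K[of y L] xK by (metis interior_atLeastAtMost_real)+
        then show "(case i of (x, K) \<Rightarrow> {Inf K<..<Sup K}) \<inter> (case j of (x, K) \<Rightarrow> {Inf K<..<Sup K}) = {}"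
          using tagged_division_ofD(5)[OF p, of x K y L] ij by auto
      qed
      \<comment> \<open>The parts of the division that absolute continuity has to handle.\<close>
      define q where "q = {(x, K) \<in> p. x \<in> N}"
      have q: "q \<subseteq> p" "finite q" using fin by (auto simp: q_def intro: finite_subset[of _ p])
      have "(\<Sum>i\<in>q. \<bar>f (Sup (snd i)) - f (Inf (snd i))\<bar>) < e / 2"
      proof (rule small)
        show "finite q" by fact
        show "a \<le> Inf (snd i) \<and> Inf (snd i) \<le> Sup (snd i) \<and> Sup (snd i) \<le> b" if "i \<in> q" for i
          using K[of "fst i" "snd i"] that q by auto
        show dq: "disjoint_family_on (\<lambda>i. {Inf (snd i)<..<Sup (snd i)}) q"
          using disj q(1) unfolding disjoint_family_on_def case_prod_beta by blast
        have "(\<Sum>i\<in>q. Sup (snd i) - Inf (snd i)) = (\<Sum>i\<in>q. measure lebesgue {Inf (snd i)<..<Sup (snd i)})"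
        proof (intro sum.cong refl)
          fix i assume "i \<in> q"
          then have "Inf (snd i) \<le> Sup (snd i)"
            using K[of "fst i" "snd i"] q(1) by fastforce
          then show "Sup (snd i) - Inf (snd i) = measure lebesgue {Inf (snd i)<..<Sup (snd i)}"
            by simp
        qed
        also have "\<dots> = measure lebesgue (\<Union>i\<in>q. {Inf (snd i)<..<Sup (snd i)})"
          by (rule measure_finite_Union[symmetric])
             (use q dq emeasure_lborel_box_finite[where 'a = real] in \<open>auto simp: less_top[symmetric]\<close>)
        also have "\<dots> \<le> measure lebesgue T"
        proof (rule measure_mono_fmeasurable)
          have "{Inf K<..<Sup K} \<subseteq> T" if "(x, K) \<in> q" for x K
          proof -
            have "{Inf K..Sup K} \<subseteq> T"
              using K[of x K] that by (auto simp: q_def \<gamma>_def)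
            then show ?thesis by force
          qed
          then show "(\<Union>i\<in>q. {Inf (snd i)<..<Sup (snd i)}) \<subseteq> T" by force
        qed (use mT q in auto)
        finally show "(\<Sum>i\<in>q. Sup (snd i) - Inf (snd i)) < \<delta>" using mT(2) by simp
      qed
      also have "(\<Sum>i\<in>q. \<bar>f (Sup (snd i)) - f (Inf (snd i))\<bar>)
          = (\<Sum>(x, K)\<in>q. \<bar>measure lborel K * g0 x - (f (Sup K) - f (Inf K))\<bar>)"
        by (intro sum.cong refl) (auto simp: q_def g0_def)
      finally have bad: "(\<Sum>(x, K)\<in>q. \<bar>measure lborel K * g0 x - (f (Sup K) - f (Inf K))\<bar>) < e / 2" .
      have "\<bar>measure lborel K * g0 x - (f (Sup K) - f (Inf K))\<bar> \<le> c * measure lborel K" if "(x, K) \<in> p - q" for x K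
      proof -
        have x: "x \<in> {a..b} - N" and xp: "(x, K) \<in> p"
          using that K[of x K] by (auto simp: q_def)
        have cK: "measure lborel K = Sup K - Inf K" "Inf K \<le> x" "x \<le> Sup K"
          using K[OF xp] by auto
        have "Inf K \<in> K" "Sup K \<in> K"
          using K[OF xp] by (metis atLeastAtMost_iff order_refl order_trans)+
        then have "\<bar>Inf K - x\<bar> < d x" "\<bar>Sup K - x\<bar> < d x"
          using K[OF xp] x by (auto simp: \<gamma>_def dist_real_def subset_eq abs_minus_commute)
        then have "\<bar>f (Inf K) - f x - g x * (Inf K - x)\<bar> \<le> c * \<bar>Inf K - x\<bar>"
             "\<bar>f (Sup K) - f x - g x * (Sup K - x)\<bar> \<le> c * \<bar>Sup K - x\<bar>"
          using lin[OF x, of "Inf K"] lin[OF x, of "Sup K"] K[OF xp] by auto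
        moreover have "c * \<bar>Inf K - x\<bar> + c * \<bar>Sup K - x\<bar> = c * measure lborel K"
          unfolding cK(1) using cK(2,3) by (simp add: algebra_simps)
        moreover have "measure lborel K * g0 x - (f (Sup K) - f (Inf K))
           = (f (Inf K) - f x - g x * (Inf K - x)) - (f (Sup K) - f x - g x * (Sup K - x))"
          unfolding cK(1) using x by (simp add: g0_def algebra_simps)
        ultimately show ?thesis by linarith
      qed
      then have "(\<Sum>(x, K)\<in>p - q. \<bar>measure lborel K * g0 x - (f (Sup K) - f (Inf K))\<bar>)
          \<le> (\<Sum>(x, K)\<in>p - q. c * measure lborel K)"
        by (intro sum_mono) auto
      also have "\<dots> \<le> (\<Sum>(x, K)\<in>p. c * measure lborel K)"
        using c(1) fin by (intro sum_mono2) auto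
      also have "\<dots> = c * (b - a)"
        using additive_content_tagged_division[of p a b] p ab
        by (simp add: case_prod_beta sum_distrib_left[symmetric])
      finally have good: "(\<Sum>(x, K)\<in>p - q. \<bar>measure lborel K * g0 x - (f (Sup K) - f (Inf K))\<bar>) \<le> c * (b - a)" .
      have "(\<Sum>(x, K)\<in>p. measure lborel K *\<^sub>R g0 x) - (f b - f a)
          = (\<Sum>(x, K)\<in>p. measure lborel K * g0 x - (f (Sup K) - f (Inf K)))"
        using additive_tagged_division_1[OF ab p, of f] by (simp add: case_prod_beta sum_subtractf)
      also have "\<bar>\<dots>\<bar> \<le> (\<Sum>(x, K)\<in>p. \<bar>measure lborel K * g0 x - (f (Sup K) - f (Inf K))\<bar>)"
        by (simp add: case_prod_beta sum_abs)
      also have "\<dots> = (\<Sum>(x, K)\<in>p - q. \<bar>measure lborel K * g0 x - (f (Sup K) - f (Inf K))\<bar>)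
          + (\<Sum>(x, K)\<in>q. \<bar>measure lborel K * g0 x - (f (Sup K) - f (Inf K))\<bar>)"
        by (rule sum.subset_diff[OF q(1) fin])
      also have "\<dots> < e" using good bad c(2) by linarith
      finally show ?thesis by simp
    qed
    show "\<exists>\<gamma>. gauge \<gamma> \<and> (\<forall>p. p tagged_division_of {a..b} \<and> \<gamma> fine p \<longrightarrow>
        norm ((\<Sum>(x, K)\<in>p. measure lborel K *\<^sub>R g0 x) - (f b - f a)) < e)"
      by (intro exI[of _ \<gamma>] conjI gauge allI impI bound) auto
  qed
  then show ?thesis
    by (rule has_integral_spike[OF N, rotated]) (auto simp: g0_def)
qed

lemma sum_integral_disjoint_le:
  fixes f :: "real \<Rightarrow> real"
  assumes int: "f integrable_on {lo..hi}" and nonneg: "\<And>t. t \<in> {lo..hi} \<Longrightarrow> 0 \<le> f t" and I: "finite I"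
    "\<And>i. i \<in> I \<Longrightarrow> lo \<le> a i \<and> a i \<le> b i \<and> b i \<le> hi"
    and disj: "disjoint_family_on (\<lambda>i. {a i<..<b i}) I"
  shows "(\<Sum>i\<in>I. integral {a i..b i} f) \<le> integral {lo..hi} f"
proof -
  have sub: "f integrable_on {a i..b i}" if "i \<in> I" for i
    using int I(2)[OF that] by (auto intro: integrable_subinterval_real)
  \<comment> \<open>Open intervals, because only these are disjoint; the endpoints do not affect the integrals.\<close>
  define g where "g = (\<lambda>i t. if t \<in> {a i<..<b i} then f t else 0)"
  have g: "(g i has_integral integral {a i..b i} f) {lo..hi}" if "i \<in> I" for i
  proof -
    have "(f has_integral integral {a i..b i} f) {a i<..<b i}"
      using sub[OF that] by (simp add: has_integral_Icc_iff_Ioo[symmetric] integrable_integral)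
    then show ?thesis
      unfolding g_def by (rule has_integral_restrict[THEN iffD2, rotated]) (use I(2)[OF that] in auto)
  qed
  have "((\<lambda>t. \<Sum>i\<in>I. g i t) has_integral (\<Sum>i\<in>I. integral {a i..b i} f)) {lo..hi}"
    using I(1) g by (rule has_integral_sum)
  moreover have "(f has_integral integral {lo..hi} f) {lo..hi}"
    using int by (rule integrable_integral)
  moreover have "(\<Sum>i\<in>I. g i t) \<le> f t" if t: "t \<in> {lo..hi}" for t
  proof (cases "\<exists>j\<in>I. t \<in> {a j<..<b j}")
    case True
    then obtain j where j: "j \<in> I" "t \<in> {a j<..<b j}" by blast
    then have "g i t = 0" if "i \<in> I - {j}" for i
      using disjoint_family_onD[OF disj, of i j] that by (auto simp: g_def)
    then have "(\<Sum>i\<in>I. g i t) = (\<Sum>i\<in>{j}. g i t)"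
      using I(1) j(1) by (intro sum.mono_neutral_right) auto
    then show ?thesis using j nonneg[OF t] by (auto simp: g_def)
  next
    case False
    then have "(\<Sum>i\<in>I. g i t) = 0" by (intro sum.neutral) (auto simp: g_def)
    then show ?thesis using nonneg[OF t] by simp
  qed
  ultimately show ?thesis by (rule has_integral_le)
qed

text \<open>For square-integrable \<open>u\<close> absolute continuity is quantitative: Young's inequality
  \<open>\<bar>u\<bar> \<le> c u\<^sup>2 / 2 + 1 / (2 c)\<close> bounds the sum of the integrals of \<open>\<bar>u\<bar>\<close> over disjoint intervals
  by a fixed multiple of \<open>c\<close> plus their total length over \<open>2 c\<close>.\<close>

lemma abs_cont_on_indefinite_integral:
  assumes u1: "u integrable_on {lo..hi}" and u2: "(\<lambda>t. (u t)\<^sup>2) integrable_on {lo..hi}"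
  shows "abs_cont_on lo hi (\<lambda>t. integral {lo..t} u)"
  unfolding abs_cont_on_def
proof (intro allI impI)
  fix e :: real assume e: "e > 0"
  \<comment> \<open>The \<open>+ 1\<close> makes \<open>M\<close> positive even if \<open>u\<close> vanishes almost everywhere.\<close>
  define M where "M = integral {lo..hi} (\<lambda>t. (u t)\<^sup>2) + 1"
  have M: "M > 0" "integral {lo..hi} (\<lambda>t. (u t)\<^sup>2) < M"
    using integral_nonneg[OF u2] by (auto simp: M_def)
  \<comment> \<open>With this \<open>c\<close> and total length below \<open>e * c\<close>, both Young terms are at most \<open>e / 2\<close>.\<close>
  define c where "c = e / M"
  have c: "c > 0" using e M by (simp add: c_def)
  have young: "\<bar>integral {s..t} u\<bar> \<le> c / 2 * integral {s..t} (\<lambda>t. (u t)\<^sup>2) + (t - s) / (2 * c)"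
    if "lo \<le> s" "s \<le> t" "t \<le> hi" for s t
  proof -
    have i: "u integrable_on {s..t}" "(\<lambda>t. (u t)\<^sup>2) integrable_on {s..t}"
      using u1 u2 that by (auto intro: integrable_subinterval_real)
    have "((\<lambda>x. c / 2 * (u x)\<^sup>2 + 1 / (2 * c)) has_integral
        c / 2 * integral {s..t} (\<lambda>t. (u t)\<^sup>2) + (t - s) * (1 / (2 * c))) {s..t}"
    proof (intro has_integral_add has_integral_mult_right)
      show "((\<lambda>x. (u x)\<^sup>2) has_integral integral {s..t} (\<lambda>t. (u t)\<^sup>2)) {s..t}"
        using i(2) by (rule integrable_integral)
      show "((\<lambda>x. 1 / (2 * c)) has_integral (t - s) * (1 / (2 * c))) {s..t}"
        using has_integral_const_real[of "1 / (2 * c)" s t] that by simp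
    qed
    then have I: "(\<lambda>x. c / 2 * (u x)\<^sup>2 + 1 / (2 * c)) integrable_on {s..t}"
      "integral {s..t} (\<lambda>x. c / 2 * (u x)\<^sup>2 + 1 / (2 * c))
        = c / 2 * integral {s..t} (\<lambda>t. (u t)\<^sup>2) + (t - s) / (2 * c)"
      by (auto simp: has_integral_iff)
    have "norm (u x) \<le> c / 2 * (u x)\<^sup>2 + 1 / (2 * c)" for x
    proof -
      have "0 \<le> (c * \<bar>u x\<bar> - 1)\<^sup>2" by simp
      then have "2 * c * \<bar>u x\<bar> \<le> c\<^sup>2 * (u x)\<^sup>2 + 1"
        by (simp add: power2_diff power_mult_distrib)
      then show ?thesis using c by (simp add: field_simps power2_eq_square)
    qed
    then show ?thesis
      using integral_norm_bound_integral[OF i(1) I(1)] I(2) by simp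
  qed
  have bound: "(\<Sum>i<n. \<bar>integral {lo..b i} u - integral {lo..a i} u\<bar>) < e"
    if ab: "\<forall>i<n. lo \<le> a i \<and> a i \<le> b i \<and> b i \<le> hi"
      and disj: "\<forall>i<n. \<forall>j<n. i \<noteq> j \<longrightarrow> {a i<..<b i} \<inter> {a j<..<b j} = {}"
      and small: "(\<Sum>i<n. b i - a i) < e * c" for n :: nat and a b
  proof -
    have "integral {lo..b i} u - integral {lo..a i} u = integral {a i..b i} u" if "i < n" for i
      using Henstock_Kurzweil_Integration.integral_combine[of lo "a i" "b i" u] ab that
        integrable_subinterval_real[OF u1, of lo "b i"] by fastforce
    then have "(\<Sum>i<n. \<bar>integral {lo..b i} u - integral {lo..a i} u\<bar>)
        = (\<Sum>i<n. \<bar>integral {a i..b i} u\<bar>)"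
      by (intro sum.cong) auto
    also have "\<dots> \<le> (\<Sum>i<n. c / 2 * integral {a i..b i} (\<lambda>t. (u t)\<^sup>2) + (b i - a i) / (2 * c))"
      using ab by (intro sum_mono young) auto
    also have "\<dots> = c / 2 * (\<Sum>i<n. integral {a i..b i} (\<lambda>t. (u t)\<^sup>2)) + (\<Sum>i<n. b i - a i) / (2 * c)"
      by (simp only: sum.distrib sum_distrib_left sum_divide_distrib)
    also have "\<dots> \<le> c / 2 * integral {lo..hi} (\<lambda>t. (u t)\<^sup>2) + (\<Sum>i<n. b i - a i) / (2 * c)"
      using ab disj c
      by (intro add_right_mono mult_left_mono sum_integral_disjoint_le u2)
         (auto simp: disjoint_family_on_def)
    also have "\<dots> < c / 2 * M + e * c / (2 * c)"
      using M(2) small c by (intro add_strict_mono mult_strict_left_mono divide_strict_right_mono) auto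
    also have "\<dots> = e" using c M(1) by (simp add: c_def)
    finally show ?thesis .
  qed
  have pos: "e * c > 0" using e c by simp
  show "\<exists>\<delta>>0. \<forall>(n::nat) a b. (\<forall>i<n. lo \<le> a i \<and> a i \<le> b i \<and> b i \<le> hi) \<longrightarrow>
      (\<forall>i<n. \<forall>j<n. i \<noteq> j \<longrightarrow> {a i<..<b i} \<inter> {a j<..<b j} = {}) \<longrightarrow>
      (\<Sum>i<n. b i - a i) < \<delta> \<longrightarrow>
      (\<Sum>i<n. \<bar>integral {lo..b i} u - integral {lo..a i} u\<bar>) < e"
    by (rule exI[of _ "e * c"], rule conjI[OF pos], (rule allI)+, (rule impI)+, rule bound)
qed

section \<open>Representatives of square-integrable classes\<close>

lemma sq_integrable_rep_L2: "sq_integrable (rep_L2 x)"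
  using Quotient3_rep_reflp[OF Quotient3_L2] by (simp add: L2_eq_refl_iff)

text \<open>\<open>rep_L2\<close> picks an arbitrary element of a class, so the operations on classes are
  visible on representatives only up to a null set.\<close>

lemma rep_abs_L2_AE:
  assumes "sq_integrable f"
  shows "AE t in unit_leb. rep_L2 (abs_L2 f) t = f t"
  using Quotient3_rep_abs[OF Quotient3_L2, of f] assms by (simp add: L2_eq_def)

lemma rep_minus_L2_AE: "AE t in unit_leb. rep_L2 (x - y) t = rep_L2 x t - rep_L2 y t"
proof -
  have u: "AE t in unit_leb. rep_L2 (- y) t = - rep_L2 y t"
    using rep_abs_L2_AE[OF sq_integrable_scale[OF sq_integrable_rep_L2, of "-1" y]]
    by (simp add: uminus_L2_def)
  have "AE t in unit_leb. rep_L2 (x + - y) t = rep_L2 x t + rep_L2 (- y) t"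
    using rep_abs_L2_AE[OF sq_integrable_add[OF sq_integrable_rep_L2 sq_integrable_rep_L2, of x "- y"]]
    by (simp add: plus_L2_def)
  with u show ?thesis by eventually_elim simp
qed

lemma rep_scaleR_L2_AE: "AE t in unit_leb. rep_L2 (c *\<^sub>R x) t = c * rep_L2 x t"
  using rep_abs_L2_AE[OF sq_integrable_scale[OF sq_integrable_rep_L2, of c x]]
  by (simp add: scaleR_L2_def)

lemma rep_volterra_AE:
  "AE t in unit_leb. rep_L2 (volterra u) t = (LINT s|lebesgue_on {0..t}. rep_L2 u s)"
  unfolding volterra_def map_fun_apply
  by (intro rep_abs_L2_AE sq_integrable_indefinite_integral sq_integrable_integrable
      sq_integrable_rep_L2)

lemma rep_volterra_adj_AE:
  "AE t in unit_leb. rep_L2 (volterra_adj u) t = (LINT s|lebesgue_on {t..1}. rep_L2 u s)"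
proof -
  have "L2_eq (\<lambda>t. LINT s|lebesgue_on {t..1}. rep_L2 u s) (\<lambda>t. LINT s|lebesgue_on {t..1}. rep_L2 u s)"
    by (rule volterra_adj.rsp[unfolded rel_fun_def, rule_format])
       (simp add: L2_eq_refl_iff sq_integrable_rep_L2)
  then show ?thesis
    unfolding volterra_adj_def map_fun_apply by (intro rep_abs_L2_AE) (simp add: L2_eq_refl_iff)
qed

lemma integrable_on_rep_L2:
  "rep_L2 u integrable_on {0..1}" "(\<lambda>t. (rep_L2 u t)\<^sup>2) integrable_on {0..1}"
  using sq_integrable_rep_L2[of u] sq_integrable_integrable[OF sq_integrable_rep_L2, of u]
  by (auto simp: integrable_on_lebesgue_on sq_integrable_def)

lemma AE_unit_leb_iff_negligible:
  "(AE t in unit_leb. P t) \<longleftrightarrow> (\<exists>N. negligible N \<and> (\<forall>t \<in> {0..1} - N. P t))"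
proof -
  have "(AE t in unit_leb. P t) \<longleftrightarrow> (AE t in lebesgue. t \<in> {0..1} \<longrightarrow> P t)"
    by (subst AE_restrict_space_iff) auto
  also have "\<dots> \<longleftrightarrow> (\<exists>N. negligible N \<and> (\<forall>t \<in> {0..1} - N. P t))"
  proof -
    have "{t \<in> space lebesgue. \<not> (t \<in> {0..1} \<longrightarrow> P t)} \<subseteq> N \<longleftrightarrow> (\<forall>t \<in> {0..1} - N. P t)" for N
      by auto
    then show ?thesis
      unfolding eventually_ae_filter negligible_iff_null_sets Bex_def by (simp only:)
  qed
  finally show ?thesis .
qed

section \<open>The skew part of the Volterra operator and its inverse\<close>

lemma volterra_adjointness: "inner (volterra u) w = inner u (volterra_adj w)"
  by transfer (simp add: L2_eq_refl_iff volterra_Fubini sq_integrable_integrable)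

lemma V_circ_skew: "inner (V_circ u) w = - inner u (V_circ w)"
proof -
  have "inner (volterra_adj u) w = inner u (volterra w)"
    by (metis inner_commute volterra_adjointness)
  then show ?thesis
    by (simp add: V_circ_def adjoint_volterra inner_diff_left inner_diff_right volterra_adjointness
        field_simps)
qed

text \<open>Half the difference of \<open>\<integral>\<^sub>0\<^sup>t u\<close> and \<open>\<integral>\<^sub>t\<^sup>1 u\<close>, where the second integral is the total minus the
  first.\<close>

lemma rep_V_circ_AE:
  "AE t in unit_leb. rep_L2 (V_circ u) t = integral {0..t} (rep_L2 u) - integral {0..1} (rep_L2 u) / 2"
proof -
  have "AE t in unit_leb. t \<in> {0..1}"
    by (rule AE_I2) simp
  with rep_scaleR_L2_AE[of "inverse 2" "volterra u - volterra_adj u"]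
    rep_minus_L2_AE[of "volterra u" "volterra_adj u"] rep_volterra_AE[of u] rep_volterra_adj_AE[of u]
  show ?thesis
  proof eventually_elim
    case (elim t)
    have i: "integrable unit_leb (rep_L2 u)"
      by (intro sq_integrable_integrable sq_integrable_rep_L2)
    have "(LINT s|lebesgue_on {0..t}. rep_L2 u s) = integral {0..t} (rep_L2 u)"
      using integrable_subinterval[OF i, of 0 t] elim(5) by (intro lebesgue_integral_eq_integral) auto
    moreover have "(LINT s|unit_leb. rep_L2 u s) = integral {0..1} (rep_L2 u)"
      using i by (intro lebesgue_integral_eq_integral) auto
    ultimately show ?case
      using elim integral_lebesgue_on_upper[OF i elim(5)]
      by (simp add: V_circ_def adjoint_volterra field_simps)
  qed
qed

text \<open>The graph of \<open>T2\<close> described by differentiation.  In the direction from right to left, the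
  fundamental theorem on \<open>{0..t}\<close> gives \<open>\<integral>\<^sub>0\<^sup>t y = x(t) - x(0)\<close>; at \<open>t = 1\<close> the boundary condition turns
  this into \<open>\<integral>\<^sub>0\<^sup>1 y = - 2 x(0)\<close>, so the additive constant in the formula for \<open>V_circ y\<close> is \<open>x(0)\<close>.\<close>

lemma V_circ_eq_iff:
  "V_circ y = x \<longleftrightarrow> has_L2_deriv x y \<and> ac_rep x 0 = - ac_rep x 1"
proof
  define G where "G = (\<lambda>t. integral {0..t} (rep_L2 y) - integral {0..1} (rep_L2 y) / 2)"
  assume x: "V_circ y = x"
  have "abs_cont_on 0 1 G"
    using abs_cont_on_indefinite_integral[OF integrable_on_rep_L2, of y]
    by (simp add: G_def abs_cont_on_def)
  moreover have "AE t in unit_leb. G t = rep_L2 x t"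
    using rep_V_circ_AE[of y] unfolding x by eventually_elim (simp add: G_def)
  ultimately have G: "is_ac_rep x G" by (simp add: is_ac_rep_def)
  then have "is_ac_rep x (ac_rep x)" unfolding ac_rep_def by (rule someI[of "is_ac_rep x"])
  then have eq: "ac_rep x t = G t" if "t \<in> {0..1}" for t
    using is_ac_rep_unique[OF _ G that] by blast
  obtain N where N: "negligible N"
    "\<And>t. t \<in> {0..1} - N \<Longrightarrow>
       ((\<lambda>t. integral {0..t} (rep_L2 y)) has_real_derivative rep_L2 y t) (at t within {0..1})"
    using indefinite_integral_has_real_derivative_AE[OF integrable_on_rep_L2(1)[of y]] by blast
  have "(ac_rep x has_real_derivative rep_L2 y t) (at t within {0..1})" if t: "t \<in> {0..1} - N" for t
  proof -
    have "(G has_real_derivative rep_L2 y t) (at t within {0..1})"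
      using DERIV_diff[OF N(2)[OF t] DERIV_const] by (simp add: G_def)
    then show ?thesis
      by (rule has_field_derivative_transform_within[of _ _ _ _ 1]) (use t eq in auto)
  qed
  with N(1) G have "has_L2_deriv x y"
    unfolding has_L2_deriv_def AE_unit_leb_iff_negligible L2_abs_cont_def by blast
  moreover have "ac_rep x 0 = - ac_rep x 1"
    using eq[of 0] eq[of 1] by (simp add: G_def)
  ultimately show "has_L2_deriv x y \<and> ac_rep x 0 = - ac_rep x 1" ..
next
  assume x: "has_L2_deriv x y \<and> ac_rep x 0 = - ac_rep x 1"
  then have rep: "is_ac_rep x (ac_rep x)"
    unfolding has_L2_deriv_def L2_abs_cont_def ac_rep_def by (auto intro: someI[of "is_ac_rep x"])
  obtain N where N: "negligible N"
    "\<And>t. t \<in> {0..1} - N \<Longrightarrow> (ac_rep x has_real_derivative rep_L2 y t) (at t within {0..1})"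
    using x unfolding has_L2_deriv_def AE_unit_leb_iff_negligible by blast
  have ftc: "integral {0..t} (rep_L2 y) = ac_rep x t - ac_rep x 0" if t: "t \<in> {0..1}" for t
  proof (rule integral_unique, rule abs_cont_on_has_integral)
    show "abs_cont_on 0 t (ac_rep x)"
      using rep t by (auto simp: is_ac_rep_def intro: abs_cont_on_subinterval)
    show "(ac_rep x has_real_derivative rep_L2 y s) (at s within {0..t})" if "s \<in> {0..t} - N" for s
      by (rule DERIV_subset[OF N(2)]) (use that t in auto)
  qed (use N t in auto)
  show "V_circ y = x"
  proof (rule rep_L2_AE_eqD)
    have "AE t in unit_leb. ac_rep x t = rep_L2 x t"
      using rep by (simp add: is_ac_rep_def)
    moreover have "AE t in unit_leb. t \<in> {0..1}"
      by (rule AE_I2) simp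
    ultimately show "AE t in unit_leb. rep_L2 (V_circ y) t = rep_L2 x t"
      using rep_V_circ_AE[of y]
    proof eventually_elim
      case (elim t)
      then show ?case using ftc[of t] ftc[of 1] x by (simp add: field_simps)
    qed
  qed
qed

theorem theorem4p8:
  shows "op_dom T2 = {x. L2_abs_cont x \<and> (\<exists>y. has_L2_deriv x y) \<and> ac_rep x 0 = - ac_rep x 1}
       \<and> (\<forall>x \<in> op_dom T2. T2 x = {L2_deriv x})
       \<and> op_adjoint T2 = op_uminus T2
       \<and> maximal_monotone_op T2 \<and> skew_op T2
       \<and> maximal_monotone_op (op_uminus T2) \<and> skew_op (op_uminus T2)"
proof -
  have T2: "T2 x = {y. has_L2_deriv x y \<and> ac_rep x 0 = - ac_rep x 1}" for x
    by (auto simp: T2_def op_inverse_def op_of_fun_def gra_def V_circ_eq_iff[symmetric])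
  then have "op_dom T2 = {x. L2_abs_cont x \<and> (\<exists>y. has_L2_deriv x y) \<and> ac_rep x 0 = - ac_rep x 1}"
    by (auto simp: op_dom_def has_L2_deriv_def)
  moreover have "\<forall>x \<in> op_dom T2. T2 x = {L2_deriv x}"
    using has_L2_deriv_unique by (auto simp: op_dom_def T2 L2_deriv_eq)
  moreover have "inner (- V_circ u) w = - inner u (- V_circ w)" for u w
    using V_circ_skew[of u w] by simp
  ultimately show ?thesis
    using adjoint_op_inverse[of V_circ, OF V_circ_skew]
      maximal_monotone_op_inverse[of V_circ, OF V_circ_skew] skew_op_inverse[of V_circ, OF V_circ_skew]
      maximal_monotone_op_inverse[of "\<lambda>u. - V_circ u"] skew_op_inverse[of "\<lambda>u. - V_circ u"]
      op_uminus_inverse_fun[of V_circ, OF V_circ_skew]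
    by (simp add: T2_def[symmetric])
qed

end
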